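(* Let $G$ be a Polish group, $X$ a $G$-space and $\sigma:G\times X\to\mathbb{R}$ a bounded (measurable) additive cocycle. Let $\mu$ be a probability measure on $G$ with support $S$. Denote $\kappa_S:=\sup\{\sup_{x\in X}|\sigma(g,x)|:g\in S\}$. Let $\nu$ be a $\mu$-stationary probability measure on $X$ and $$\ell(\mu):=\int_{G\times X}\sigma(g,x)\,d\mu(g)\,d\nu(x).$$ Assume that the set $E$ of bounded measurable solutions $\psi$ of the Poisson equation $$\psi(x)-P_\mu\psi(x)=\int_G\sigma(g,x)\,d\mu(g)-\ell(\mu)$$ is non-empty and let $\mathfrak{c}:=\inf\{\|\psi\|_\infty:\psi\in E\}$. Then, for every $t>0$, $n\in\mathbb{N}$ and $x\in X$, we have $$\mathbb{P}\left(|\sigma(L_n,x)-n\ell(\mu)|\geq nt\right)\leq 2\exp\left(-\frac{nt^2}{32(\kappa_S+\mathfrak{c})^2}\right).$$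
   Context: A $G$-space is a standard Borel space $X$ endowed with a measurable action of the Polish group $G$ (with its Borel $\sigma$-algebra). $\sigma:G\times X\to\mathbb{R}$ is an additive cocycle if $\sigma(g_1g_2,x)=\sigma(g_1,g_2x)+\sigma(g_2,x)$ for all $g_1,g_2\in G$, $x\in X$; all cocycles are assumed measurable. $\nu$ is $\mu$-stationary if $\iint\phi(gx)\,d\mu(g)\,d\nu(x)=\int\phi\,d\nu$ for every bounded measurable $\phi$ on $X$. $P_\mu$ acts on bounded measurable functions by $P_\mu\phi(x)=\int\phi(gx)\,d\mu(g)$. $(X_i)_{i\ge1}$ are i.i.d. $G$-valued random variables with law $\mu$, and $L_n=X_n\cdots X_1$. *)

theory Defs
  imports "HOL-Probability.Probability"
begin

text \<open>
  The class \<open>polish_space\<close> carries a compatible complete metric; no group axiom refers to it, so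
  every Polish group yields an instance. The last axiom only ties the operation \<open>/\<close>, which comes
  with the syntactic class \<open>inverse\<close>, to multiplication.
\<close>

class polish_group = polish_space + topological_monoid_mult + inverse +
  assumes left_inverse: "inverse a * a = 1"
    and right_inverse: "a * inverse a = 1"
    and tendsto_inverse_nhds: "(inverse \<longlongrightarrow> inverse a) (nhds a)"
    and divide_eq_mult_inverse: "a / b = a * inverse b"

definition standard_borel :: "'x measure \<Rightarrow> bool" where
  "standard_borel M \<longleftrightarrow>
     (\<exists>T. completely_metrizable_space T \<and> second_countable T \<and> topspace T = space M \<and>
          sets M = sigma_sets (space M) {U. openin T U})"

text \<open>
  Here and below, \<open>M\<close> stands for a measurable space; the measure it carries is irrelevant.
\<close>

definition G_space :: "'x measure \<Rightarrow> ('g::polish_group \<Rightarrow> 'x \<Rightarrow> 'x) \<Rightarrow> bool" where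
  "G_space M act \<longleftrightarrow>
     standard_borel M \<and>
     (\<lambda>(g, x). act g x) \<in> measurable (borel \<Otimes>\<^sub>M M) M \<and>
     (\<forall>x\<in>space M. act 1 x = x) \<and>
     (\<forall>g h. \<forall>x\<in>space M. act (g * h) x = act g (act h x))"

definition additive_cocycle ::
  "'x measure \<Rightarrow> ('g::polish_group \<Rightarrow> 'x \<Rightarrow> 'x) \<Rightarrow> ('g \<Rightarrow> 'x \<Rightarrow> real) \<Rightarrow> bool" where
  "additive_cocycle M act \<sigma> \<longleftrightarrow>
     (\<lambda>(g, x). \<sigma> g x) \<in> borel_measurable (borel \<Otimes>\<^sub>M M) \<and>
     (\<forall>g h. \<forall>x\<in>space M. \<sigma> (g * h) x = \<sigma> g (act h x) + \<sigma> h x)"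

definition bounded_cocycle :: "'x measure \<Rightarrow> ('g \<Rightarrow> 'x \<Rightarrow> real) \<Rightarrow> bool" where
  "bounded_cocycle M \<sigma> \<longleftrightarrow> (\<exists>C. \<forall>g. \<forall>x\<in>space M. \<bar>\<sigma> g x\<bar> \<le> C)"

definition support :: "'g::topological_space measure \<Rightarrow> 'g set" where
  "support \<mu> = {g. \<forall>U. open U \<longrightarrow> g \<in> U \<longrightarrow> emeasure \<mu> U > 0}"

definition sup_norm :: "'x measure \<Rightarrow> ('x \<Rightarrow> real) \<Rightarrow> real" where
  "sup_norm M \<psi> = (SUP x\<in>space M. \<bar>\<psi> x\<bar>)"

definition bounded_measurable :: "'x measure \<Rightarrow> ('x \<Rightarrow> real) set" where
  "bounded_measurable M = {\<psi> \<in> borel_measurable M. \<exists>C. \<forall>x\<in>space M. \<bar>\<psi> x\<bar> \<le> C}"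

definition markov_op :: "'g measure \<Rightarrow> ('g \<Rightarrow> 'x \<Rightarrow> 'x) \<Rightarrow> ('x \<Rightarrow> real) \<Rightarrow> 'x \<Rightarrow> real" where
  "markov_op \<mu> act \<phi> x = (LINT g|\<mu>. \<phi> (act g x))"

definition stationary ::
  "'g measure \<Rightarrow> 'x measure \<Rightarrow> ('g \<Rightarrow> 'x \<Rightarrow> 'x) \<Rightarrow> 'x measure \<Rightarrow> bool" where
  "stationary \<mu> M act \<nu> \<longleftrightarrow>
     (\<forall>\<phi>\<in>bounded_measurable M. (LINT x|\<nu>. LINT g|\<mu>. \<phi> (act g x)) = (LINT x|\<nu>. \<phi> x))"

definition cocycle_sup :: "'x measure \<Rightarrow> ('g \<Rightarrow> 'x \<Rightarrow> real) \<Rightarrow> 'g set \<Rightarrow> real" where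
  "cocycle_sup M \<sigma> S = (SUP g\<in>S. SUP x\<in>space M. \<bar>\<sigma> g x\<bar>)"

definition drift :: "'g measure \<Rightarrow> 'x measure \<Rightarrow> ('g \<Rightarrow> 'x \<Rightarrow> real) \<Rightarrow> real" where
  "drift \<mu> \<nu> \<sigma> = (LINT (g, x)|(\<mu> \<Otimes>\<^sub>M \<nu>). \<sigma> g x)"

definition poisson_solutions ::
  "'g measure \<Rightarrow> 'x measure \<Rightarrow> ('g \<Rightarrow> 'x \<Rightarrow> 'x) \<Rightarrow> ('g \<Rightarrow> 'x \<Rightarrow> real) \<Rightarrow> 'x measure \<Rightarrow> ('x \<Rightarrow> real) set"
  where
  "poisson_solutions \<mu> M act \<sigma> \<nu> =
     {\<psi> \<in> bounded_measurable M.
        \<forall>x\<in>space M. \<psi> x - markov_op \<mu> act \<psi> x = (LINT g|\<mu>. \<sigma> g x) - drift \<mu> \<nu> \<sigma>}"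

text \<open>
  The left random walk \<open>L n = X n * \<dots> * X 1\<close>; the value \<open>X 0\<close> is not used.
\<close>

primrec left_walk :: "(nat \<Rightarrow> 'w \<Rightarrow> 'g::monoid_mult) \<Rightarrow> nat \<Rightarrow> 'w \<Rightarrow> 'g" where
  "left_walk X 0 \<omega> = 1"
| "left_walk X (Suc n) \<omega> = X (Suc n) \<omega> * left_walk X n \<omega>"

end

theory Submission
  imports Defs "HOL-Real_Asymp.Real_Asymp"
begin

text \<open>
  If \<open>\<psi>\<close> solves the Poisson equation, then
  \<open>W\<^sub>n = \<sigma>(L\<^sub>n, x) - n l + \<psi>(L\<^sub>n x) - \<psi>(x)\<close> is a martingale. Given the past, its \<open>n\<close>-th increment
  lies in an interval of length \<open>2 (\<kappa> + \<parallel>\<psi>\<parallel>)\<close>, so Hoeffding's lemma and Chernoff's bound give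
  Gaussian tails for \<open>W\<^sub>n\<close>. The coboundary term \<open>\<psi>(L\<^sub>n x) - \<psi>(x)\<close> is at most \<open>n t / 2\<close> as soon as
  \<open>n t \<ge> 4 \<parallel>\<psi>\<parallel>\<close>; for smaller \<open>n\<close> the claimed bound exceeds 1. Finally \<open>\<parallel>\<psi>\<parallel>\<close> tends to its infimum.
\<close>

section \<open>Support of a Borel measure\<close>

text \<open>By second countability, countably many basic open sets of measure zero cover the
  complement of the support.\<close>

lemma AE_in_support:
  fixes \<mu> :: "'g::second_countable_topology measure"
  assumes "sets \<mu> = sets borel"
  shows "AE g in \<mu>. g \<in> support \<mu>"
proof -
  obtain B :: "'g set set" where B: "countable B" "topological_basis B"
    using ex_countable_basis by blast
  define N where "N = {b \<in> B. emeasure \<mu> b = 0}"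
  have "countable N"
    using B(1) by (simp add: N_def)
  then have null: "(\<Union>b\<in>N. b) \<in> null_sets \<mu>"
  proof (rule null_sets_UN')
    fix b assume "b \<in> N"
    then show "b \<in> null_sets \<mu>"
      using topological_basis_open[OF B(2)] assms by (auto simp: N_def intro!: null_setsI)
  qed
  have "{g \<in> space \<mu>. g \<notin> support \<mu>} \<subseteq> (\<Union>b\<in>N. b)"
  proof
    fix g assume "g \<in> {g \<in> space \<mu>. g \<notin> support \<mu>}"
    then obtain U where U: "open U" "g \<in> U" "emeasure \<mu> U = 0"
      by (auto simp: support_def zero_less_iff_neq_zero)
    obtain b where b: "b \<in> B" "g \<in> b" "b \<subseteq> U"
      using topological_basisE[OF B(2) U(1,2)] by blast
    have "emeasure \<mu> b \<le> emeasure \<mu> U"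
      using U(1) b(3) assms by (intro emeasure_mono) auto
    with U(3) b show "g \<in> (\<Union>b\<in>N. b)"
      by (auto simp: N_def)
  qed
  then show ?thesis
    by (rule AE_I'[OF null])
qed

section \<open>Measurability and independence of the left random walk\<close>

lemma borel_measurable_mult_monoid [measurable]:
  fixes f g :: "'a \<Rightarrow> 'g::{second_countable_topology, topological_monoid_mult}"
  assumes [measurable]: "f \<in> borel_measurable N" "g \<in> borel_measurable N"
  shows "(\<lambda>x. f x * g x) \<in> borel_measurable N"
  by (rule borel_measurable_continuous_Pair[OF assms]) (intro continuous_intros)

lemma left_walk_measurable:
  fixes X :: "nat \<Rightarrow> 'w \<Rightarrow> 'g::{second_countable_topology, topological_monoid_mult}"
  assumes "\<And>i. i \<in> {1..n} \<Longrightarrow> X i \<in> borel_measurable N"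
  shows "left_walk X n \<in> borel_measurable N"
proof -
  have "left_walk X 0 = (\<lambda>_. 1)" "left_walk X (Suc m) = (\<lambda>\<omega>. X (Suc m) \<omega> * left_walk X m \<omega>)" for m
    by auto
  with assms show ?thesis
    by (induction n) (simp_all add: borel_measurable_mult_monoid)
qed

text \<open>Run on the coordinate projections, \<open>left_walk\<close> becomes a function of the
  tuple of steps; this exhibits \<open>left_walk X n\<close> as a function of the first
  \<open>n\<close> steps alone.\<close>

lemma left_walk_restrict:
  "left_walk (\<lambda>i f. f i) n (\<lambda>i\<in>{1..m}. X i \<omega>) = left_walk X n \<omega>" if "n \<le> m"
  using that by (induction n) auto

text \<open>The index blocks \<open>{1..n}\<close> and \<open>{Suc n}\<close> are disjoint, so the
  tuples of steps over them are independent, and the walk is a measurable function of the first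
  tuple.\<close>

lemma (in prob_space) indep_var_left_walk:
  fixes X :: "nat \<Rightarrow> 'a \<Rightarrow> 'g::{second_countable_topology, topological_monoid_mult}"
  assumes "indep_vars (\<lambda>_. borel) X {1..}"
  shows "indep_var borel (left_walk X n) borel (X (Suc n))"
proof -
  let ?A = "{1..n}" and ?B = "{Suc n}"
  have "indep_var (PiM ?A (\<lambda>_. borel)) (\<lambda>\<omega>. \<lambda>i\<in>?A. X i \<omega>) (PiM ?B (\<lambda>_. borel)) (\<lambda>\<omega>. \<lambda>i\<in>?B. X i \<omega>)"
    using assms by (rule indep_var_restrict) auto
  then have "indep_var borel (left_walk (\<lambda>i f. f i) n \<circ> (\<lambda>\<omega>. \<lambda>i\<in>?A. X i \<omega>))
      borel ((\<lambda>f. f (Suc n)) \<circ> (\<lambda>\<omega>. \<lambda>i\<in>?B. X i \<omega>))"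
    by (rule indep_var_compose) (auto intro!: left_walk_measurable)
  then show ?thesis
    by (simp add: comp_def left_walk_restrict del: One_nat_def)
qed

section \<open>Exponential moments and Gaussian tails\<close>

text \<open>A negative \<open>s\<close> reduces to the positive case for \<open>- f\<close>, whose
  values lie in \<open>{-b..-a}\<close>, an interval of the same length. Both signs serve the
  two-sided tail below.\<close>

lemma (in prob_space) Hoeffdings_lemma_all:
  fixes s :: real
  assumes [measurable]: "random_variable borel f"
    and ab: "AE x in M. f x \<in> {a..b}"
    and E0: "expectation f = 0"
  shows "(\<integral>\<^sup>+x. exp (s * f x) \<partial>M) \<le> ennreal (exp (s\<^sup>2 * (b - a)\<^sup>2 / 8))"
proof -
  consider "s > 0" | "s = 0" | "s < 0" by linarith
  then show ?thesis
  proof cases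
    case 1
    interpret interval_bounded_random_variable M f a b
      by unfold_locales (use ab in auto)
    show ?thesis using 1 E0 by (rule Hoeffdings_lemma_nn_integral_0)
  next
    case 2
    then show ?thesis by (simp add: emeasure_space_1)
  next
    case 3
    interpret interval_bounded_random_variable M "\<lambda>x. - f x" "-b" "-a"
      by unfold_locales (use ab in auto)
    have "(\<integral>\<^sup>+x. exp ((-s) * (- f x)) \<partial>M) \<le> ennreal (exp ((-s)\<^sup>2 * (-a - -b)\<^sup>2 / 8))"
      using 3 E0 by (intro Hoeffdings_lemma_nn_integral_0) auto
    then show ?thesis by simp
  qed
qed

text \<open>Chernoff's bound is applied to \<open>W\<close> and to \<open>- W\<close>; adding the
  two tails gives the factor 2.\<close>

lemma (in prob_space) subgaussian_tail:
  fixes W :: "'a \<Rightarrow> real"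
  assumes [measurable]: "random_variable borel W"
    and mgf: "\<And>s. (\<integral>\<^sup>+x. exp (s * W x) \<partial>M) \<le> ennreal (exp (s\<^sup>2 * v / 2))"
    and "v > 0" "u > 0"
  shows "prob {x \<in> space M. \<bar>W x\<bar> \<ge> u} \<le> 2 * exp (- u\<^sup>2 / (2 * v))"
proof -
  \<comment> \<open>This value minimizes the Chernoff exponent
    \<open>- s * u + s\<^sup>2 * v / 2\<close>.\<close>
  define s where "s = u / v"
  have s: "s > 0" using assms by (simp add: s_def)
  \<comment> \<open>The sign \<open>\<epsilon>\<close> treats both tails at once: the moment bound
    at \<open>s * \<epsilon>\<close> depends only on its square.\<close>
  have one: "prob {x \<in> space M. \<epsilon> * W x \<ge> u} \<le> exp (- u\<^sup>2 / (2 * v))" if \<epsilon>: "\<epsilon>\<^sup>2 = 1" for \<epsilon> :: real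
  proof -
    have "emeasure M {x \<in> space M. \<epsilon> * W x \<ge> u} \<le>
        ennreal (exp (-s * u)) * (\<integral>\<^sup>+x\<in>space M. exp (s * (\<epsilon> * W x)) \<partial>M)"
      using s by (intro Chernoff_ineq_nn_integral_ge) auto
    also have "(\<integral>\<^sup>+x\<in>space M. exp (s * (\<epsilon> * W x)) \<partial>M) = (\<integral>\<^sup>+x. exp ((s * \<epsilon>) * W x) \<partial>M)"
      by (intro nn_integral_cong) (simp add: mult.assoc)
    also have "ennreal (exp (-s * u)) * \<dots> \<le> ennreal (exp (-s * u)) * ennreal (exp ((s * \<epsilon>)\<^sup>2 * v / 2))"
      by (intro mult_left_mono mgf) auto
    also have "\<dots> = ennreal (exp (-s * u + s\<^sup>2 * v / 2))"
      using \<epsilon> by (simp add: power_mult_distrib flip: ennreal_mult exp_add)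
    also have "-s * u + s\<^sup>2 * v / 2 = - u\<^sup>2 / (2 * v)"
      using \<open>v > 0\<close> by (simp add: s_def field_simps power2_eq_square)
    finally show ?thesis
      by (simp add: emeasure_eq_measure)
  qed
  have "prob {x \<in> space M. \<bar>W x\<bar> \<ge> u} \<le>
      prob ({x \<in> space M. 1 * W x \<ge> u} \<union> {x \<in> space M. (-1) * W x \<ge> u})"
    by (intro finite_measure_mono) auto
  also have "\<dots> \<le> prob {x \<in> space M. 1 * W x \<ge> u} + prob {x \<in> space M. (-1) * W x \<ge> u}"
    by (intro measure_Un_le) auto
  also have "\<dots> \<le> 2 * exp (- u\<^sup>2 / (2 * v))"
    using one[of 1] one[of "-1"] by simp
  finally show ?thesis .
qed

section \<open>The cocycle along the random walk\<close>

locale cocycle_walk =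
  fixes M :: "'x measure"
    and act :: "'g::polish_group \<Rightarrow> 'x \<Rightarrow> 'x"
    and \<sigma> :: "'g \<Rightarrow> 'x \<Rightarrow> real"
    and \<mu> :: "'g measure"
    and P :: "'w measure"
    and X :: "nat \<Rightarrow> 'w \<Rightarrow> 'g"
  assumes G_space: "G_space M act"
    and cocycle: "additive_cocycle M act \<sigma>"
    and prob_\<mu>: "prob_space \<mu>" and sets_\<mu> [measurable_cong]: "sets \<mu> = sets borel"
    and prob_P: "prob_space P"
    and indep: "prob_space.indep_vars P (\<lambda>_. borel) X {1..}"
    and distr_X: "\<And>i. i \<ge> 1 \<Longrightarrow> distr P borel (X i) = \<mu>"
begin

sublocale \<mu>: prob_space \<mu> by (fact prob_\<mu>)
sublocale P: prob_space P by (fact prob_P)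

lemma act_measurable [measurable]:
  assumes [measurable]: "f \<in> borel_measurable N" "h \<in> measurable N M"
  shows "(\<lambda>z. act (f z) (h z)) \<in> measurable N M"
proof -
  have [measurable]: "(\<lambda>(g, x). act g x) \<in> measurable (borel \<Otimes>\<^sub>M M) M"
    using G_space by (simp add: G_space_def)
  have "(\<lambda>z. (\<lambda>(g, x). act g x) (f z, h z)) \<in> measurable N M"
    by measurable
  then show ?thesis by simp
qed

lemma cocycle_measurable [measurable]:
  assumes [measurable]: "f \<in> borel_measurable N" "h \<in> measurable N M"
  shows "(\<lambda>z. \<sigma> (f z) (h z)) \<in> borel_measurable N"
proof -
  have [measurable]: "(\<lambda>(g, x). \<sigma> g x) \<in> borel_measurable (borel \<Otimes>\<^sub>M M)"
    using cocycle by (simp add: additive_cocycle_def)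
  have "(\<lambda>z. (\<lambda>(g, x). \<sigma> g x) (f z, h z)) \<in> borel_measurable N"
    by measurable
  then show ?thesis by simp
qed

lemma act_in_space: "x \<in> space M \<Longrightarrow> act g x \<in> space M"
  using measurable_space[OF act_measurable[of "\<lambda>_. g" M "\<lambda>x. x"]] by simp

lemma act_one: "x \<in> space M \<Longrightarrow> act 1 x = x"
  and act_mult: "x \<in> space M \<Longrightarrow> act (g * h) x = act g (act h x)"
  using G_space by (auto simp: G_space_def)

lemma cocycle_mult: "x \<in> space M \<Longrightarrow> \<sigma> (g * h) x = \<sigma> g (act h x) + \<sigma> h x"
  using cocycle by (auto simp: additive_cocycle_def)

lemma cocycle_one: "x \<in> space M \<Longrightarrow> \<sigma> 1 x = 0"
  using cocycle_mult[of x 1 1] by (simp add: act_one)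

lemma walk_measurable [measurable]: "left_walk X n \<in> borel_measurable P"
  using indep by (intro left_walk_measurable) (auto simp: P.indep_vars_def)

definition increment :: "('x \<Rightarrow> real) \<Rightarrow> real \<Rightarrow> 'g \<Rightarrow> 'x \<Rightarrow> real" where
  "increment \<psi> l g y = \<sigma> g y - l + \<psi> (act g y) - \<psi> y"

text \<open>A function of the group element instead of the sample point, so that it can be
  integrated against the law of the walk.\<close>

definition walk_martingale :: "('x \<Rightarrow> real) \<Rightarrow> real \<Rightarrow> 'x \<Rightarrow> nat \<Rightarrow> 'g \<Rightarrow> real" where
  "walk_martingale \<psi> l x n h = \<sigma> h x - real n * l + \<psi> (act h x) - \<psi> x"

text \<open>The cocycle identity splits off \<open>\<sigma> g (act h x)\<close>, and the
  intermediate value \<open>\<psi> (act h x)\<close> cancels.\<close>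

lemma walk_martingale_Suc:
  "x \<in> space M \<Longrightarrow> walk_martingale \<psi> l x (Suc n) (g * h) =
     walk_martingale \<psi> l x n h + increment \<psi> l g (act h x)"
  by (simp add: walk_martingale_def increment_def cocycle_mult act_mult algebra_simps)

section \<open>Martingale estimates for a fixed solution of the Poisson equation\<close>

text \<open>\<open>C\<close> is any bound for \<open>\<psi>\<close>, so that it can later be chosen
  slightly above an infimum that may not be attained. The bound \<open>K\<close> is only almost sure
  because \<open>\<kappa>\<close> controls \<open>\<sigma>\<close> on the support alone.\<close>

context
  fixes \<psi> :: "'x \<Rightarrow> real" and l K C :: real
  assumes \<psi> [measurable]: "\<psi> \<in> borel_measurable M"
    and \<psi>_bound: "\<And>y. y \<in> space M \<Longrightarrow> \<bar>\<psi> y\<bar> \<le> C"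
    and \<sigma>_bound: "AE g in \<mu>. \<forall>y\<in>space M. \<bar>\<sigma> g y\<bar> \<le> K"
    and poisson: "\<And>y. y \<in> space M \<Longrightarrow> \<psi> y - markov_op \<mu> act \<psi> y = (LINT g|\<mu>. \<sigma> g y) - l"
begin

text \<open>The Poisson equation says exactly that the increment has mean zero, so Hoeffding's lemma
  applies at each fixed position \<open>y\<close>.\<close>

lemma increment_mgf:
  assumes y [measurable]: "y \<in> space M"
  shows "(\<integral>\<^sup>+g. exp (s * increment \<psi> l g y) \<partial>\<mu>) \<le> ennreal (exp (s\<^sup>2 * (K + C)\<^sup>2 / 2))"
proof -
  \<comment> \<open>Only \<open>\<sigma> g y\<close> and \<open>\<psi> (act g y)\<close> vary with
    \<open>g\<close>; \<open>l\<close> and \<open>\<psi> y\<close> merely shift the interval. Hence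
    its length is \<open>2 * (K + C)\<close> rather than \<open>2 * (K + 2 * C)\<close>.\<close>
  have ae: "AE g in \<mu>. increment \<psi> l g y \<in> {- K - C - l - \<psi> y .. K + C - l - \<psi> y}"
    using \<sigma>_bound
  proof eventually_elim
    case (elim g)
    with y have "\<bar>\<sigma> g y\<bar> \<le> K" by blast
    moreover have "\<bar>\<psi> (act g y)\<bar> \<le> C"
      using y by (intro \<psi>_bound act_in_space)
    ultimately show ?case
      unfolding increment_def by auto
  qed
  have i\<sigma>: "integrable \<mu> (\<lambda>g. \<sigma> g y)"
    by (rule \<mu>.integrable_const_bound[where B = K]) (use \<sigma>_bound y in auto)
  have i\<psi>: "integrable \<mu> (\<lambda>g. \<psi> (act g y))"
    by (rule \<mu>.integrable_const_bound[where B = C]) (use \<psi>_bound act_in_space y in auto)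
  have "\<mu>.expectation (\<lambda>g. increment \<psi> l g y) = (LINT g|\<mu>. \<sigma> g y) - l + markov_op \<mu> act \<psi> y - \<psi> y"
    unfolding increment_def markov_op_def using i\<sigma> i\<psi> by (simp add: \<mu>.prob_space)
  also have "\<dots> = 0"
    using poisson[OF y] by simp
  finally have "(\<integral>\<^sup>+g. exp (s * increment \<psi> l g y) \<partial>\<mu>) \<le>
      ennreal (exp (s\<^sup>2 * ((K + C - l - \<psi> y) - (- K - C - l - \<psi> y))\<^sup>2 / 8))"
    by (intro \<mu>.Hoeffdings_lemma_all ae) (auto simp: increment_def)
  also have "s\<^sup>2 * ((K + C - l - \<psi> y) - (- K - C - l - \<psi> y))\<^sup>2 / 8 = s\<^sup>2 * (K + C)\<^sup>2 / 2"
    by (simp add: field_simps power2_eq_square)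
  finally show ?thesis .
qed

text \<open>Given the walk up to time \<open>n\<close>, the factor of the next step is bounded by
  \<open>increment_mgf\<close> uniformly in the position, so each step of the induction multiplies
  the bound by the same constant.\<close>

lemma walk_martingale_mgf:
  assumes x [measurable]: "x \<in> space M"
  shows "(\<integral>\<^sup>+\<omega>. exp (s * walk_martingale \<psi> l x n (left_walk X n \<omega>)) \<partial>P) \<le>
    ennreal (exp (s\<^sup>2 * (real n * (K + C)\<^sup>2) / 2))"
proof (induction n)
  case 0
  show ?case
    using x by (simp add: walk_martingale_def cocycle_one act_one P.emeasure_space_1)
next
  case (Suc n)
  have [measurable]: "X (Suc n) \<in> borel_measurable P"
    using indep by (auto simp: P.indep_vars_def)
  define L where "L = distr P borel (left_walk X n)"
  have [measurable_cong]: "sets L = sets borel"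
    by (simp add: L_def)
  interpret L: prob_space L
    unfolding L_def by (intro P.prob_space_distr) simp
  define F where "F = (\<lambda>h. ennreal (exp (s * walk_martingale \<psi> l x n h)))"
  have [measurable]: "F \<in> borel_measurable borel"
    unfolding F_def walk_martingale_def by measurable
  define D where "D = (\<lambda>h g. ennreal (exp (s * increment \<psi> l g (act h x))))"
  have [measurable]: "(\<lambda>p. D (fst p) (snd p)) \<in> borel_measurable (borel \<Otimes>\<^sub>M borel)"
    unfolding D_def increment_def by measurable
  \<comment> \<open>By independence the joint law is a product, so conditioning on the past becomes
    Tonelli's theorem: the new step is integrated out first.\<close>
  have joint: "distr P (borel \<Otimes>\<^sub>M borel) (\<lambda>\<omega>. (left_walk X n \<omega>, X (Suc n) \<omega>)) = L \<Otimes>\<^sub>M \<mu>"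
    using P.indep_var_left_walk[OF indep, of n] distr_X[of "Suc n"]
    by (simp add: P.indep_var_distribution_eq L_def)
  have "(\<integral>\<^sup>+\<omega>. exp (s * walk_martingale \<psi> l x (Suc n) (left_walk X (Suc n) \<omega>)) \<partial>P) =
      (\<integral>\<^sup>+\<omega>. F (left_walk X n \<omega>) * D (left_walk X n \<omega>) (X (Suc n) \<omega>) \<partial>P)"
    using x by (simp add: F_def D_def walk_martingale_Suc distrib_left exp_add ennreal_mult)
  also have "\<dots> = (\<integral>\<^sup>+p. F (fst p) * D (fst p) (snd p)
      \<partial>distr P (borel \<Otimes>\<^sub>M borel) (\<lambda>\<omega>. (left_walk X n \<omega>, X (Suc n) \<omega>)))"
    by (subst nn_integral_distr) auto
  also have "\<dots> = (\<integral>\<^sup>+h. \<integral>\<^sup>+g. F h * D h g \<partial>\<mu> \<partial>L)"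
    unfolding joint by (subst \<mu>.nn_integral_fst[symmetric]) auto
  also have "\<dots> = (\<integral>\<^sup>+h. F h * (\<integral>\<^sup>+g. D h g \<partial>\<mu>) \<partial>L)"
    unfolding D_def increment_def by (intro nn_integral_cong nn_integral_cmult) measurable
  also have "\<dots> \<le> (\<integral>\<^sup>+h. F h * ennreal (exp (s\<^sup>2 * (K + C)\<^sup>2 / 2)) \<partial>L)"
    unfolding D_def by (intro nn_integral_mono mult_left_mono increment_mgf act_in_space x) auto
  also have "\<dots> = (\<integral>\<^sup>+h. F h \<partial>L) * ennreal (exp (s\<^sup>2 * (K + C)\<^sup>2 / 2))"
    by (rule nn_integral_multc) measurable
  also have "(\<integral>\<^sup>+h. F h \<partial>L) = (\<integral>\<^sup>+\<omega>. F (left_walk X n \<omega>) \<partial>P)"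
    unfolding L_def by (subst nn_integral_distr) auto
  also have "\<dots> * ennreal (exp (s\<^sup>2 * (K + C)\<^sup>2 / 2)) \<le>
      ennreal (exp (s\<^sup>2 * (real n * (K + C)\<^sup>2) / 2)) * ennreal (exp (s\<^sup>2 * (K + C)\<^sup>2 / 2))"
    unfolding F_def by (intro mult_right_mono Suc.IH) auto
  also have "\<dots> = ennreal (exp (s\<^sup>2 * (real (Suc n) * (K + C)\<^sup>2) / 2))"
    by (simp add: algebra_simps add_divide_distrib flip: ennreal_mult exp_add)
  finally show ?case .
qed

lemma cocycle_deviation:
  assumes x [measurable]: "x \<in> space M" and "t > 0" "n > 0" "K \<ge> 0" "K + C > 0"
  shows "P.prob {\<omega> \<in> space P. \<bar>\<sigma> (left_walk X n \<omega>) x - real n * l\<bar> \<ge> real n * t} \<le>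
    2 * exp (- (real n * t\<^sup>2) / (32 * (K + C)\<^sup>2))"
\<comment> \<open>The two values of \<open>\<psi>\<close> change the deviation by at most
  \<open>2 * C\<close>, which in the first case is at most half of
  \<open>real n * t\<close>.\<close>
proof (cases "real n * t \<ge> 4 * C")
  case True
  define W where "W = (\<lambda>\<omega>. walk_martingale \<psi> l x n (left_walk X n \<omega>))"
  have W [measurable]: "W \<in> borel_measurable P"
    unfolding W_def walk_martingale_def by measurable
  have "P.prob {\<omega> \<in> space P. \<bar>\<sigma> (left_walk X n \<omega>) x - real n * l\<bar> \<ge> real n * t} \<le>
      P.prob {\<omega> \<in> space P. \<bar>W \<omega>\<bar> \<ge> real n * t / 2}"
  proof (intro P.finite_measure_mono subsetI)
    fix \<omega> assume "\<omega> \<in> {\<omega> \<in> space P. \<bar>\<sigma> (left_walk X n \<omega>) x - real n * l\<bar> \<ge> real n * t}"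
    then have "\<omega> \<in> space P" "\<bar>\<sigma> (left_walk X n \<omega>) x - real n * l\<bar> \<ge> real n * t"
      by simp_all
    moreover have "\<bar>\<psi> (act (left_walk X n \<omega>) x)\<bar> \<le> C" "\<bar>\<psi> x\<bar> \<le> C"
      using \<psi>_bound act_in_space x by blast+
    moreover have "u / 2 \<le> \<bar>a + p - q\<bar>"
      if "u \<le> \<bar>a\<bar>" "\<bar>p\<bar> \<le> C" "\<bar>q\<bar> \<le> C" "4 * C \<le> u" for a p q u :: real
      using that by linarith
    ultimately show "\<omega> \<in> {\<omega> \<in> space P. \<bar>W \<omega>\<bar> \<ge> real n * t / 2}"
      using True by (simp add: W_def walk_martingale_def)
  qed measurable
  \<comment> \<open>Threshold \<open>real n * t / 2\<close> and variance proxy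
    \<open>real n * (K + C)\<^sup>2\<close> yield the constant 8; the weaker 32 is what the other
    case uses.\<close>
  also have "\<dots> \<le> 2 * exp (- (real n * t / 2)\<^sup>2 / (2 * (real n * (K + C)\<^sup>2)))"
    using assms by (intro P.subgaussian_tail[OF W]) (simp_all add: W_def walk_martingale_mgf)
  also have "- (real n * t / 2)\<^sup>2 / (2 * (real n * (K + C)\<^sup>2)) = - (real n * t\<^sup>2) / (8 * (K + C)\<^sup>2)"
    using \<open>n > 0\<close> by (simp add: power_mult_distrib power_divide) (simp add: power2_eq_square)
  also have "\<dots> \<le> - (real n * t\<^sup>2) / (32 * (K + C)\<^sup>2)"
  proof -
    have "real n * t\<^sup>2 / (32 * (K + C)\<^sup>2) \<le> real n * t\<^sup>2 / (8 * (K + C)\<^sup>2)"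
      using \<open>K + C > 0\<close> by (intro divide_left_mono mult_right_mono) simp_all
    then show ?thesis by simp
  qed
  finally show ?thesis by simp
next
  case False
  \<comment> \<open>From \<open>real n * t < 4 * C\<close> and \<open>n > 0\<close> the exponent is
    at least -1/2, and \<open>2 * exp (- 1 / 2)\<close> is at least 1 by
    \<open>exp z \<ge> 1 + z\<close>; so the trivial bound on a probability suffices.\<close>
  have "real n * t\<^sup>2 \<le> (real n * t)\<^sup>2"
    using \<open>n > 0\<close> self_le_power[of "real n" 2] by (simp add: power_mult_distrib mult_right_mono)
  also have "\<dots> \<le> (4 * (K + C))\<^sup>2"
    using False assms by (intro power_mono) simp_all
  also have "\<dots> = 16 * (K + C)\<^sup>2"
    by (simp only: power_mult_distrib) simp
  finally have "real n * t\<^sup>2 / (32 * (K + C)\<^sup>2) \<le> 1 / 2"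
    using assms by (simp add: pos_divide_le_eq)
  then have "exp (- 1 / 2) \<le> exp (- (real n * t\<^sup>2) / (32 * (K + C)\<^sup>2))"
    by simp
  moreover have "1 \<le> 2 * exp (- 1 / 2 :: real)"
    using exp_ge_add_one_self[of "- 1 / 2 :: real"] by simp
  ultimately have "1 \<le> 2 * exp (- (real n * t\<^sup>2) / (32 * (K + C)\<^sup>2))"
    by linarith
  then show ?thesis
    using P.prob_le_1 by (rule order_trans[rotated])
qed

end

end

section \<open>Suprema, and passage to the infimum over all solutions\<close>

lemma sup_norm_upper:
  assumes "\<psi> \<in> bounded_measurable M" "y \<in> space M"
  shows "\<bar>\<psi> y\<bar> \<le> sup_norm M \<psi>"
  using assms unfolding sup_norm_def bounded_measurable_def
  by (intro cSUP_upper) (auto simp: bdd_above_def)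

text \<open>A real supremum controls its members only over a bounded set; the global bound
  \<open>C\<close> of the cocycle serves both nested suprema.\<close>

lemma cocycle_sup_upper:
  assumes "bounded_cocycle M \<sigma>" "g \<in> S" "y \<in> space M"
  shows "\<bar>\<sigma> g y\<bar> \<le> cocycle_sup M \<sigma> S"
proof -
  obtain C where C: "\<And>g y. y \<in> space M \<Longrightarrow> \<bar>\<sigma> g y\<bar> \<le> C"
    using assms(1) by (auto simp: bounded_cocycle_def)
  have "\<bar>\<sigma> g y\<bar> \<le> (SUP y\<in>space M. \<bar>\<sigma> g y\<bar>)"
    using C assms(3) by (intro cSUP_upper) (auto simp: bdd_above_def)
  also have "\<dots> \<le> cocycle_sup M \<sigma> S"
    unfolding cocycle_sup_def
  proof (rule cSUP_upper[OF assms(2)])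
    show "bdd_above ((\<lambda>g. SUP y\<in>space M. \<bar>\<sigma> g y\<bar>) ` S)"
      using C assms(3) by (intro bdd_aboveI2[where M = C] cSUP_least) auto
  qed
  finally show ?thesis .
qed

text \<open>Division by zero gives 0, so for \<open>\<kappa> + c = 0\<close> the first conjunct only
  says that the probability is at most 2. The second conjunct restores the intended reading, with
  right-hand side 0. It needs \<open>n > 0\<close>: for \<open>n = 0\<close> the event is
  certain.\<close>

theorem proposition2p1:
  fixes M :: "'x measure"
    and act :: "'g::polish_group \<Rightarrow> 'x \<Rightarrow> 'x"
    and \<sigma> :: "'g \<Rightarrow> 'x \<Rightarrow> real"
    and \<mu> :: "'g measure"
    and \<nu> :: "'x measure"
    and P :: "'w measure"
    and X :: "nat \<Rightarrow> 'w \<Rightarrow> 'g"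
    and S :: "'g set"
    and E :: "('x \<Rightarrow> real) set"
    and \<kappa> l c t :: real
    and n :: nat
    and x :: 'x
  assumes "G_space M act"
    and "additive_cocycle M act \<sigma>"
    and "bounded_cocycle M \<sigma>"
    and "prob_space \<mu>" and "sets \<mu> = sets borel"
    and "S = support \<mu>"
    and "\<kappa> = cocycle_sup M \<sigma> S"
    and "prob_space \<nu>" and "sets \<nu> = sets M"
    and "stationary \<mu> M act \<nu>"
    and "l = drift \<mu> \<nu> \<sigma>"
    and "E = poisson_solutions \<mu> M act \<sigma> \<nu>"
    and "E \<noteq> {}"
    and "c = (INF \<psi>\<in>E. sup_norm M \<psi>)"
    and "prob_space P"
    and "prob_space.indep_vars P (\<lambda>_. borel) X {1..}"
    and "\<And>i. i \<ge> 1 \<Longrightarrow> distr P borel (X i) = \<mu>"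
    and "t > 0"
    and "x \<in> space M"
  shows "measure P {\<omega> \<in> space P. \<bar>\<sigma> (left_walk X n \<omega>) x - real n * l\<bar> \<ge> real n * t}
           \<le> 2 * exp (- (real n * t\<^sup>2) / (32 * (\<kappa> + c)\<^sup>2))
         \<and> (\<kappa> + c = 0 \<and> n > 0 \<longrightarrow>
              measure P {\<omega> \<in> space P. \<bar>\<sigma> (left_walk X n \<omega>) x - real n * l\<bar> \<ge> real n * t} = 0)"
proof -
  interpret cocycle_walk M act \<sigma> \<mu> P X
    by (rule cocycle_walk.intro[OF assms(1,2,4,5,15,16,17)])
  let ?p = "measure P {\<omega> \<in> space P. \<bar>\<sigma> (left_walk X n \<omega>) x - real n * l\<bar> \<ge> real n * t}"
  define bound where "bound = (\<lambda>R::real. 2 * exp (- (real n * t\<^sup>2) / (32 * R\<^sup>2)))"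
  have \<sigma>_le: "AE g in \<mu>. \<forall>y\<in>space M. \<bar>\<sigma> g y\<bar> \<le> \<kappa>"
    using AE_in_support[OF assms(5)]
  proof eventually_elim
    case (elim g)
    then show ?case using cocycle_sup_upper[OF assms(3)] by (simp add: assms(6,7))
  qed
  \<comment> \<open>An almost sure statement that does not mention \<open>g\<close> is true, since
    \<open>\<mu>\<close> has mass 1.\<close>
  have "AE g in \<mu>. 0 \<le> \<kappa>"
    using \<sigma>_le
  proof eventually_elim
    case (elim g)
    then show ?case using \<open>x \<in> space M\<close> abs_ge_zero[of "\<sigma> g x"] by (blast intro: order_trans)
  qed
  then have \<kappa>: "\<kappa> \<ge> 0" by simp
  have norm_nonneg: "0 \<le> sup_norm M \<psi>" if "\<psi> \<in> E" for \<psi>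
    using that assms(12) sup_norm_upper[of \<psi> M x] \<open>x \<in> space M\<close>
    by (auto simp: poisson_solutions_def intro: order_trans[OF abs_ge_zero])
  have c: "c \<ge> 0"
    unfolding assms(14) using assms(13) norm_nonneg by (intro cINF_greatest)
  have upper: "?p \<le> bound R" if "n > 0" "R > \<kappa> + c" for R
  proof -
    \<comment> \<open>Taking \<open>C = R - \<kappa>\<close> makes \<open>K + C\<close> equal to
      \<open>R\<close>; strictness of \<open>R > \<kappa> + c\<close> provides a solution with norm
      below \<open>C\<close>.\<close>
    have "(INF \<psi>\<in>E. sup_norm M \<psi>) < R - \<kappa>"
      using that assms(14) by simp
    then obtain \<psi> where \<psi>: "\<psi> \<in> E" "sup_norm M \<psi> < R - \<kappa>"
      using assms(13) norm_nonneg by (subst (asm) cINF_less_iff) (auto intro!: bdd_belowI2[where m = 0])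
    have bm: "\<psi> \<in> bounded_measurable M"
      using \<psi>(1) assms(12) by (simp add: poisson_solutions_def)
    have "?p \<le> 2 * exp (- (real n * t\<^sup>2) / (32 * (\<kappa> + (R - \<kappa>))\<^sup>2))"
    proof (rule cocycle_deviation)
      show "\<psi> \<in> borel_measurable M"
        using bm by (simp add: bounded_measurable_def)
      show "\<bar>\<psi> y\<bar> \<le> R - \<kappa>" if "y \<in> space M" for y
        using sup_norm_upper[OF bm that] \<psi>(2) by linarith
      show "\<psi> y - markov_op \<mu> act \<psi> y = (LINT g|\<mu>. \<sigma> g y) - l" if "y \<in> space M" for y
        using \<psi>(1) that assms(11,12) by (simp add: poisson_solutions_def)
      show "AE g in \<mu>. \<forall>y\<in>space M. \<bar>\<sigma> g y\<bar> \<le> \<kappa>"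
        by (fact \<sigma>_le)
    qed (use \<kappa> c that assms(18,19) in simp_all)
    then show ?thesis by (simp add: bound_def)
  qed
  \<comment> \<open>The limit \<open>b\<close> is left free: it is
    \<open>bound (\<kappa> + c)\<close> in the regular case and 0 in the degenerate one.\<close>
  have limit: "?p \<le> b" if "n > 0" "(bound \<longlongrightarrow> b) (at_right (\<kappa> + c))" for b
  proof (rule tendsto_lowerbound[OF that(2)])
    show "eventually (\<lambda>R. ?p \<le> bound R) (at_right (\<kappa> + c))"
      using upper[OF \<open>n > 0\<close>] by (auto simp: eventually_at_right_field intro: gt_ex)
  qed simp
  show ?thesis
  proof (cases "n > 0 \<and> \<kappa> + c \<noteq> 0")
    case True
    then have "(bound \<longlongrightarrow> bound (\<kappa> + c)) (at_right (\<kappa> + c))"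
      unfolding bound_def by (intro tendsto_intros) auto
    then have "?p \<le> bound (\<kappa> + c)"
      using True limit by blast
    then show ?thesis
      using True by (simp add: bound_def)
  next
    case False
    \<comment> \<open>Here the exponent is \<open>0\<close>, because \<open>n = 0\<close> or because of division by zero.\<close>
    then have "2 * exp (- (real n * t\<^sup>2) / (32 * (\<kappa> + c)\<^sup>2)) = 2"
      by auto
    then have "?p \<le> 2 * exp (- (real n * t\<^sup>2) / (32 * (\<kappa> + c)\<^sup>2))"
      by (simp only: order_trans[OF P.prob_le_1 one_le_numeral])
    moreover have "?p = 0" if "\<kappa> + c = 0" "n > 0"
    proof -
      \<comment> \<open>The value \<open>bound 0\<close> is 2 by the division convention, but the
        exponent tends to minus infinity from the right.\<close>
      have "((\<lambda>R. 2 * exp (- a / (32 * R\<^sup>2))) \<longlongrightarrow> 0) (at_right 0)" if "a > 0" for a :: real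
        using that by real_asymp
      from this[of "real n * t\<^sup>2"] have "(bound \<longlongrightarrow> 0) (at_right 0)"
        using that assms(18) by (simp add: bound_def)
      then have "?p \<le> 0"
        using that limit by simp
      then show ?thesis
        by (simp add: measure_le_0_iff)
    qed
    ultimately show ?thesis by blast
  qed
qed

end
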